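(* Let $\mathscr T=(V,\mathcal E)$ be the directed Cartesian product of locally finite rooted directed trees $\mathscr T_1,\ldots,\mathscr T_d$ and let $S_{\boldsymbol\lambda_{\mathfrak c}}$ be a member of $\mathcal S_{\mathscr T}$. Let $F=\{i_1,\ldots,i_k\}\subseteq\{1,\ldots,d\}$ for some positive integer $k\in\{1,\ldots,d\}$, let $u\in\Omega_F$, and let $\mathcal L_{u,F}$ be the subspace of $l^2(\mathsf{sib}_F(u))$ appearing in the decomposition $\bigcap_{j=1}^d\ker S_j^*=\bigoplus_{F\in\mathscr P}\bigoplus_{u\in\Omega_F}\mathcal L_{u,F}$. Then $\mathcal L_{u,F}$ is isomorphic to the finite dimensional space $$\ker X_{i_1}\otimes\cdots\otimes\ker X_{i_k},$$ where for $j\in F$ the linear functional $X_j:l^2(\mathsf{sib}(u_j))\to\mathbb C$ is given by $X_j(f)=\sum_{\eta\in\mathsf{sib}(u_j)}f(\eta)$. In particular, $$\dim\mathcal L_{u,F}=\prod_{j\in F}(\mathrm{card}(\mathsf{sib}(u_j))-1).$$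
   Context: Conventions: $\mathbb N=\{0,1,2,\ldots\}$; $|\alpha|=\sum_j\alpha_j$ for $\alpha\in\mathbb N^d$. $\mathscr P$ is the set of all subsets of $\{1,\ldots,d\}$. Trees: a rooted directed tree is a connected directed graph without circuits in which every vertex has at most one parent and exactly one vertex (the root) has no parent. $\mathsf{Chi}(u)$ is the set of children of $u$; for a non-root $u$, $\mathsf{par}(u)$ is its parent and $\mathsf{sib}(u)=\mathsf{Chi}(\mathsf{par}(u))$ (so $u\in\mathsf{sib}(u)$). All directed trees are assumed countably infinite and leafless (every vertex has at least one child). Locally finite: every $\mathsf{Chi}(u)$ is finite. The depth of $u$ is the length of the path from the root to $u$. Products: for rooted directed trees $\mathscr T_j=(V_j,\mathcal E_j)$ with roots $\mathsf{root}_j$, the directed Cartesian product $\mathscr T=(V,\mathcal E)$ has $V=V_1\times\cdots\times V_d$ and $(v,w)\in\mathcal E$ iff there is $k$ with $v_j=w_j$ for $j\neq k$ and $(v_k,w_k)\in\mathcal E_k$. The depth of $v\in V$ is $\mathsf d_v=(\mathsf d_{v_1},\ldots,\mathsf d_{v_d})$, $\mathsf d_{v_j}$ being the depth of $v_j$ in $\mathscr T_j$. $\mathsf{Chi}_j(v)$ (resp. $\mathsf{sib}_j(v)$, for $v_j\neq\mathsf{root}_j$) is the set of $w\in V$ with $w_i=v_i$ for $i\ne j$ and $w_j\in\mathsf{Chi}(v_j)$ (resp. $w_j\in\mathsf{sib}(v_j)$). Family $\mathcal S_{\mathscr T}$: for a sequence $\mathfrak c:\mathbb N\to(0,\infty)$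 put $$\lambda_j(w)=\sqrt{\frac{\mathfrak c(|\mathsf d_v|)}{\mathrm{card}(\mathsf{Chi}_j(v))}}\sqrt{\frac{\mathsf d_{v_j}+1}{|\mathsf d_v|+d}},\quad w\in\mathsf{Chi}_j(v),\ v\in V,\ j=1,\ldots,d.$$ On $l^2(V)$ with orthonormal basis $\{e_v\}_{v\in V}$ of indicator functions, $S_{\boldsymbol\lambda_{\mathfrak c}}=(S_1,\ldots,S_d)$ is the (commuting, bounded if $\mathfrak c$ is bounded) multishift $S_je_v=\sum_{w\in\mathsf{Chi}_j(v)}\lambda_j(w)e_w$. $\mathcal S_{\mathscr T}=\{S_{\boldsymbol\lambda_{\mathfrak c}}:\inf\mathfrak c>0,\ \sup\mathfrak c<\infty\}$. Spaces $\mathcal L_{u,F}$: for $F\in\mathscr P$ let $\Phi_F=\{v\in V: v_j\neq\mathsf{root}_j\text{ if }j\in F,\ v_j=\mathsf{root}_j\text{ if }j\notin F\}$. For $u\in\Phi_F$, $\mathsf{sib}_F(u)$ is the set of $w\in V$ with $w_j\in\mathsf{sib}(u_j)$ for $j\in F$ and $w_j=u_j$ for $j\notin F$. These sets partition $\Phi_F$, and $\Omega_F$ is any set containing exactly one element of each class. For $G\in\mathscr P$, $v_G$ is $v$ with all coordinates $v_j$, $j\notin G$, replaced by $\mathsf{root}_j$; $\mathsf{sib}_{F,G}(u)=\{v_G: v\in\mathsf{sib}_F(u)\}$ for $G\subseteq F$; for $j\notin G$, $v_G|u_j$ is $v_G$ with $j$-th coordinate replaced by $u_j$. $\mathcal L_{u,F}\subseteq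 l^2(\mathsf{sib}_F(u))$ is the space of $f$ with $\sum_{w\in\mathsf{sib}_j(v_G|u_j)}f(w)\lambda_j(w)=0$ for all $j\in F$, $G=F\setminus\{j\}$, $v_G\in\mathsf{sib}_{F,G}(u)$. *)

theory Defs
  imports "HOL-Analysis.Analysis" "HOL-Library.Function_Algebras" "HOL-Library.Set_Algebras"
begin

section \<open>Rooted directed trees\<close>

record 'a digraph =
  nodes :: "'a set"
  edges :: "('a \<times> 'a) set"

definition Chi :: "'a digraph \<Rightarrow> 'a \<Rightarrow> 'a set" where
  "Chi T u = {w. (u, w) \<in> edges T}"

definition is_root :: "'a digraph \<Rightarrow> 'a \<Rightarrow> bool" where
  "is_root T r \<longleftrightarrow> r \<in> nodes T \<and> (\<forall>v. (v, r) \<notin> edges T)"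

definition rooted_directed_tree :: "'a digraph \<Rightarrow> bool" where
  "rooted_directed_tree T \<longleftrightarrow>
     edges T \<subseteq> nodes T \<times> nodes T \<and>
     (\<forall>u\<in>nodes T. \<forall>v\<in>nodes T. (u, v) \<in> (edges T \<union> (edges T)\<inverse>)\<^sup>*) \<and>
     acyclic (edges T) \<and>
     (\<forall>u v w. (v, u) \<in> edges T \<and> (w, u) \<in> edges T \<longrightarrow> v = w) \<and>
     (\<exists>!r. is_root T r)"

definition leafless :: "'a digraph \<Rightarrow> bool" where
  "leafless T \<longleftrightarrow> (\<forall>u\<in>nodes T. Chi T u \<noteq> {})"

definition locally_finite_tree :: "'a digraph \<Rightarrow> bool" where
  "locally_finite_tree T \<longleftrightarrow> (\<forall>u\<in>nodes T. finite (Chi T u))"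

definition troot :: "'a digraph \<Rightarrow> 'a" where
  "troot T = (THE r. is_root T r)"

definition par :: "'a digraph \<Rightarrow> 'a \<Rightarrow> 'a" where
  "par T u = (THE v. (v, u) \<in> edges T)"

definition sib :: "'a digraph \<Rightarrow> 'a \<Rightarrow> 'a set" where
  "sib T u = Chi T (par T u)"

definition depth :: "'a digraph \<Rightarrow> 'a \<Rightarrow> nat" where
  "depth T u = (THE n. (troot T, u) \<in> edges T ^^ n)"


section \<open>Directed Cartesian products\<close>

text \<open>The factors are \<open>T 1, \<dots>, T d\<close>; a vertex of the product is a function on \<open>{1..d}\<close>,
  extended by \<open>undefined\<close>.\<close>

definition tree_prod :: "nat \<Rightarrow> (nat \<Rightarrow> 'a digraph) \<Rightarrow> (nat \<Rightarrow> 'a) digraph" where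
  "tree_prod d T =
     (let V = (\<Pi>\<^sub>E j\<in>{1..d}. nodes (T j)) in
      \<lparr>nodes = V,
       edges = {(v, w). v \<in> V \<and> w \<in> V \<and>
         (\<exists>k\<in>{1..d}. (\<forall>j\<in>{1..d} - {k}. v j = w j) \<and> (v k, w k) \<in> edges (T k))}\<rparr>)"

abbreviation prod_nodes :: "nat \<Rightarrow> (nat \<Rightarrow> 'a digraph) \<Rightarrow> (nat \<Rightarrow> 'a) set" where
  "prod_nodes d T \<equiv> nodes (tree_prod d T)"

definition total_depth :: "nat \<Rightarrow> (nat \<Rightarrow> 'a digraph) \<Rightarrow> (nat \<Rightarrow> 'a) \<Rightarrow> nat" where
  "total_depth d T v = (\<Sum>j\<in>{1..d}. depth (T j) (v j))"

definition Chi_at :: "nat \<Rightarrow> (nat \<Rightarrow> 'a digraph) \<Rightarrow> nat \<Rightarrow> (nat \<Rightarrow> 'a) \<Rightarrow> (nat \<Rightarrow> 'a) set" where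
  "Chi_at d T j v =
     {w \<in> prod_nodes d T. (\<forall>i\<in>{1..d} - {j}. w i = v i) \<and> w j \<in> Chi (T j) (v j)}"

definition sib_at :: "nat \<Rightarrow> (nat \<Rightarrow> 'a digraph) \<Rightarrow> nat \<Rightarrow> (nat \<Rightarrow> 'a) \<Rightarrow> (nat \<Rightarrow> 'a) set" where
  "sib_at d T j v =
     {w \<in> prod_nodes d T. (\<forall>i\<in>{1..d} - {j}. w i = v i) \<and> w j \<in> sib (T j) (v j)}"


section \<open>Complex sequence spaces and their linear algebra\<close>

definition cscale :: "complex \<Rightarrow> ('x \<Rightarrow> complex) \<Rightarrow> 'x \<Rightarrow> complex" where
  "cscale c f = (\<lambda>x. c * f x)"

global_interpretation cfun: vector_space "cscale :: complex \<Rightarrow> ('x \<Rightarrow> complex) \<Rightarrow> 'x \<Rightarrow> complex"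
  by unfold_locales (auto simp: cscale_def fun_eq_iff algebra_simps)

text \<open>Elements of \<open>l2 A\<close> are functions on the ambient type vanishing outside \<open>A\<close>.\<close>

definition l2 :: "'x set \<Rightarrow> ('x \<Rightarrow> complex) set" where
  "l2 A = {f. (\<forall>x. x \<notin> A \<longrightarrow> f x = 0) \<and> (\<lambda>x. (cmod (f x))\<^sup>2) summable_on A}"

definition basis_vec :: "'x \<Rightarrow> 'x \<Rightarrow> complex" where
  "basis_vec v = (\<lambda>x. if x = v then 1 else 0)"


section \<open>The multishifts\<close>

text \<open>The weight at \<open>w\<close> is expressed through \<open>v\<close>, the unique vertex with
  \<open>w \<in> Chi_at d T j v\<close>; it is meaningful only if \<open>w j\<close> is not the root of \<open>T j\<close>.\<close>

definition weight :: "nat \<Rightarrow> (nat \<Rightarrow> 'a digraph) \<Rightarrow> (nat \<Rightarrow> real) \<Rightarrow> nat \<Rightarrow> (nat \<Rightarrow> 'a) \<Rightarrow> real" where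
  "weight d T c j w =
     (let v = w(j := par (T j) (w j)) in
      sqrt (c (total_depth d T v) / real (card (Chi_at d T j v))) *
      sqrt ((real (depth (T j) (v j)) + 1) / (real (total_depth d T v) + real d)))"

text \<open>The \<open>j\<close>-th operator is the linear extension of
  \<open>basis_vec v \<mapsto> (\<Sum>w\<in>Chi_at d T j v. \<lambda> j w basis_vec w)\<close> to \<open>l2\<close>: each \<open>w\<close> lies in
  \<open>Chi_at d T j v\<close> for at most one \<open>v\<close>, see \<open>multishift_basis_vec\<close> below.\<close>

definition multishift ::
    "nat \<Rightarrow> (nat \<Rightarrow> 'a digraph) \<Rightarrow> (nat \<Rightarrow> (nat \<Rightarrow> 'a) \<Rightarrow> real)
      \<Rightarrow> nat \<Rightarrow> ((nat \<Rightarrow> 'a) \<Rightarrow> complex) \<Rightarrow> (nat \<Rightarrow> 'a) \<Rightarrow> complex" where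
  "multishift d T lam =
     (\<lambda>j\<in>{1..d}. \<lambda>f\<in>l2 (prod_nodes d T). \<lambda>w.
        if w \<in> prod_nodes d T \<and> w j \<noteq> troot (T j)
        then of_real (lam j w) * f (w(j := par (T j) (w j))) else 0)"

lemma par_eq:
  assumes "rooted_directed_tree T" "(v, w) \<in> edges T"
  shows "par T w = v"
  unfolding par_def using assms by (intro the_equality) (auto simp: rooted_directed_tree_def)

lemma not_root_iff:
  assumes "rooted_directed_tree T" "w \<in> nodes T"
  shows "w \<noteq> troot T \<longleftrightarrow> (\<exists>v. (v, w) \<in> edges T)"
proof -
  have ex: "\<exists>!r. is_root T r"
    using assms(1) by (simp add: rooted_directed_tree_def)
  then have "is_root T (troot T)"
    unfolding troot_def by (rule theI')
  with ex have "w = troot T \<longleftrightarrow> is_root T w"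
    by blast
  then show ?thesis
    using assms(2) by (auto simp: is_root_def)
qed

lemma finite_Chi_at:
  assumes "j \<in> {1..d}" "locally_finite_tree (T j)" "v \<in> prod_nodes d T"
  shows "finite (Chi_at d T j v)"
proof (rule finite_subset)
  have "w = v(j := w j)" if "w \<in> Chi_at d T j v" for w
  proof
    fix i show "w i = (v(j := w j)) i"
    proof (cases "i \<in> {1..d}")
      case True then show ?thesis using that by (auto simp: Chi_at_def)
    next
      case False
      then have "w i = undefined" "v i = undefined"
        using that assms(3) by (auto simp: Chi_at_def tree_prod_def Let_def PiE_def extensional_def)
      then show ?thesis using False assms(1) by auto
    qed
  qed
  moreover have "w j \<in> Chi (T j) (v j)" if "w \<in> Chi_at d T j v" for w
    using that by (simp add: Chi_at_def)
  ultimately show "Chi_at d T j v \<subseteq> (\<lambda>x. v(j := x)) ` Chi (T j) (v j)"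
    by blast
  have "v j \<in> nodes (T j)"
    using assms(1,3) by (auto simp: tree_prod_def Let_def PiE_def Pi_def)
  then show "finite ((\<lambda>x. v(j := x)) ` Chi (T j) (v j))"
    using assms(2) by (simp add: locally_finite_tree_def)
qed

lemma multishift_basis_vec:
  assumes j: "j \<in> {1..d}" and tree: "rooted_directed_tree (T j)"
    and fin: "locally_finite_tree (T j)" and v: "v \<in> prod_nodes d T"
  shows "multishift d T lam j (basis_vec v) =
    (\<Sum>w\<in>Chi_at d T j v. cscale (of_real (lam j w)) (basis_vec w))"
proof
  fix w
  have "basis_vec v \<in> l2 (prod_nodes d T)"
  proof -
    have "(\<lambda>x. (cmod (basis_vec v x))\<^sup>2) summable_on prod_nodes d T
        \<longleftrightarrow> (\<lambda>x. (cmod (basis_vec v x))\<^sup>2) summable_on {v}"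
      using v by (intro summable_on_cong_neutral) (auto simp: basis_vec_def)
    then show ?thesis
      using v by (auto simp: l2_def basis_vec_def)
  qed
  then have lhs: "multishift d T lam j (basis_vec v) w =
      (if w \<in> prod_nodes d T \<and> w j \<noteq> troot (T j) \<and> w(j := par (T j) (w j)) = v
       then of_real (lam j w) else 0)"
    using j by (simp add: multishift_def basis_vec_def)
  have sum_apply: "(\<Sum>y\<in>A. h y) w = (\<Sum>y\<in>A. h y w)"
    for A and h :: "(nat \<Rightarrow> 'a) \<Rightarrow> (nat \<Rightarrow> 'a) \<Rightarrow> complex"
    by (induction A rule: infinite_finite_induct) auto
  have rhs: "(\<Sum>y\<in>Chi_at d T j v. cscale (of_real (lam j y)) (basis_vec y)) w =
      (if w \<in> Chi_at d T j v then of_real (lam j w) else 0)"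
    using finite_Chi_at[of j d T v] j fin v
    by (simp add: sum_apply cscale_def basis_vec_def if_distrib sum.delta' cong: if_cong)
  have "w \<in> prod_nodes d T \<and> w j \<noteq> troot (T j) \<and> w(j := par (T j) (w j)) = v
      \<longleftrightarrow> w \<in> Chi_at d T j v"
  proof (cases "w \<in> prod_nodes d T")
    case False then show ?thesis by (simp add: Chi_at_def)
  next
    case w: True
    then have wj: "w j \<in> nodes (T j)"
      using j by (auto simp: tree_prod_def Let_def PiE_def Pi_def)
    have ext: "w i = v i" if "i \<notin> {1..d}" for i
      using that w v by (auto simp: tree_prod_def Let_def PiE_def extensional_def)
    show ?thesis
    proof
      assume a: "w \<in> prod_nodes d T \<and> w j \<noteq> troot (T j) \<and> w(j := par (T j) (w j)) = v"
      then obtain p where p: "(p, w j) \<in> edges (T j)"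
        using not_root_iff[OF tree wj] by blast
      from a have eq: "w(j := par (T j) (w j)) = v" by simp
      have "v j = p" using par_eq[OF tree p] fun_cong[OF eq, of j] by simp
      moreover have "w i = v i" if "i \<noteq> j" for i
        using fun_cong[OF eq, of i] that by simp
      ultimately show "w \<in> Chi_at d T j v"
        using w p by (simp add: Chi_at_def Chi_def)
    next
      assume a: "w \<in> Chi_at d T j v"
      then have e: "(v j, w j) \<in> edges (T j)" by (simp add: Chi_at_def Chi_def)
      have "w i = v i" if "i \<noteq> j" for i
        using a ext that by (cases "i \<in> {1..d}") (auto simp: Chi_at_def)
      then have "w(j := par (T j) (w j)) = v"
        using par_eq[OF tree e] by auto
      then show "w \<in> prod_nodes d T \<and> w j \<noteq> troot (T j) \<and> w(j := par (T j) (w j)) = v"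
        using w e not_root_iff[OF tree wj] by blast
    qed
  qed
  then show "multishift d T lam j (basis_vec v) w =
      (\<Sum>y\<in>Chi_at d T j v. cscale (of_real (lam j y)) (basis_vec y)) w"
    unfolding lhs rhs by simp
qed

definition shift_family ::
    "nat \<Rightarrow> (nat \<Rightarrow> 'a digraph)
      \<Rightarrow> (nat \<Rightarrow> ((nat \<Rightarrow> 'a) \<Rightarrow> complex) \<Rightarrow> (nat \<Rightarrow> 'a) \<Rightarrow> complex) set" where
  "shift_family d T =
     {multishift d T (weight d T c) | c.
        (\<forall>n. 0 < c n) \<and> 0 < (INF n. c n) \<and> bdd_above (range c)}"


section \<open>The spaces \<open>L\<^sub>u\<^sub>,\<^sub>F\<close>\<close>

definition Phi :: "nat \<Rightarrow> (nat \<Rightarrow> 'a digraph) \<Rightarrow> nat set \<Rightarrow> (nat \<Rightarrow> 'a) set" where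
  "Phi d T F = {v \<in> prod_nodes d T. \<forall>j\<in>{1..d}. j \<in> F \<longleftrightarrow> v j \<noteq> troot (T j)}"

definition sib_set :: "nat \<Rightarrow> (nat \<Rightarrow> 'a digraph) \<Rightarrow> nat set \<Rightarrow> (nat \<Rightarrow> 'a) \<Rightarrow> (nat \<Rightarrow> 'a) set" where
  "sib_set d T F u = {w \<in> prod_nodes d T.
     \<forall>j\<in>{1..d}. (j \<in> F \<longrightarrow> w j \<in> sib (T j) (u j)) \<and> (j \<notin> F \<longrightarrow> w j = u j)}"

definition transversal :: "nat \<Rightarrow> (nat \<Rightarrow> 'a digraph) \<Rightarrow> nat set \<Rightarrow> (nat \<Rightarrow> 'a) set \<Rightarrow> bool" where
  "transversal d T F \<Omega> \<longleftrightarrow>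
     \<Omega> \<subseteq> Phi d T F \<and> (\<forall>C \<in> sib_set d T F ` Phi d T F. \<exists>!u. u \<in> \<Omega> \<inter> C)"

definition restr :: "nat \<Rightarrow> (nat \<Rightarrow> 'a digraph) \<Rightarrow> nat set \<Rightarrow> (nat \<Rightarrow> 'a) \<Rightarrow> nat \<Rightarrow> 'a" where
  "restr d T G v = (\<lambda>j\<in>{1..d}. if j \<in> G then v j else troot (T j))"

definition sib_restr ::
    "nat \<Rightarrow> (nat \<Rightarrow> 'a digraph) \<Rightarrow> nat set \<Rightarrow> nat set \<Rightarrow> (nat \<Rightarrow> 'a) \<Rightarrow> (nat \<Rightarrow> 'a) set" where
  "sib_restr d T F G u = restr d T G ` sib_set d T F u"

definition L_space ::
    "nat \<Rightarrow> (nat \<Rightarrow> 'a digraph) \<Rightarrow> (nat \<Rightarrow> (nat \<Rightarrow> 'a) \<Rightarrow> real)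
      \<Rightarrow> nat set \<Rightarrow> (nat \<Rightarrow> 'a) \<Rightarrow> ((nat \<Rightarrow> 'a) \<Rightarrow> complex) set" where
  "L_space d T lam F u = {f \<in> l2 (sib_set d T F u).
     \<forall>j\<in>F. \<forall>vG \<in> sib_restr d T F (F - {j}) u.
       (\<Sum>w \<in> sib_at d T j (vG(j := u j)). f w * of_real (lam j w)) = 0}"

definition X_functional :: "'a digraph \<Rightarrow> 'a \<Rightarrow> ('a \<Rightarrow> complex) \<Rightarrow> complex" where
  "X_functional T x f = (\<Sum>\<eta>\<in>sib T x. f \<eta>)"

definition ker_X :: "'a digraph \<Rightarrow> 'a \<Rightarrow> ('a \<Rightarrow> complex) set" where
  "ker_X T x = {f \<in> l2 (sib T x). X_functional T x f = 0}"


section \<open>Tensor products\<close>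

record 'v lin_space =
  pts :: "'v set"
  vadd :: "'v \<Rightarrow> 'v \<Rightarrow> 'v"
  vscale :: "complex \<Rightarrow> 'v \<Rightarrow> 'v"

definition as_space :: "('x \<Rightarrow> complex) set \<Rightarrow> ('x \<Rightarrow> complex) lin_space" where
  "as_space W = \<lparr>pts = W, vadd = (+), vscale = cscale\<rparr>"

definition lin_isomorphic :: "'v lin_space \<Rightarrow> 'w lin_space \<Rightarrow> bool" where
  "lin_isomorphic A B \<longleftrightarrow> (\<exists>\<phi>. bij_betw \<phi> (pts A) (pts B) \<and>
     (\<forall>x\<in>pts A. \<forall>y\<in>pts A. \<phi> (vadd A x y) = vadd B (\<phi> x) (\<phi> y)) \<and>
     (\<forall>c. \<forall>x\<in>pts A. \<phi> (vscale A c x) = vscale B c (\<phi> x)))"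

text \<open>Some finite set is contained in no proper linear subspace. (A nonempty set closed under
  scaling contains the zero vector.)\<close>

definition finite_dimensional :: "'v lin_space \<Rightarrow> bool" where
  "finite_dimensional A \<longleftrightarrow> (\<exists>B. finite B \<and> B \<subseteq> pts A \<and>
     (\<forall>S. S \<noteq> {} \<and> B \<subseteq> S \<and> S \<subseteq> pts A \<and>
        (\<forall>x\<in>S. \<forall>y\<in>S. vadd A x y \<in> S) \<and> (\<forall>c. \<forall>x\<in>S. vscale A c x \<in> S) \<longrightarrow> S = pts A))"

text \<open>The quotient \<open>M / N\<close> of function spaces. Scaling is followed by adding \<open>N\<close> so that
  multiplication by \<open>0\<close> yields the coset \<open>N\<close>.\<close>

definition quotient_space ::
    "('x \<Rightarrow> complex) set \<Rightarrow> ('x \<Rightarrow> complex) set \<Rightarrow> ('x \<Rightarrow> complex) set lin_space" where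
  "quotient_space M N =
     \<lparr>pts = (\<lambda>x. x +o N) ` M, vadd = (+), vscale = (\<lambda>c A. cscale c ` A + N)\<rparr>"

text \<open>The tensor product of the family \<open>W j\<close>, \<open>j \<in> I\<close>: the free vector space on the tuples,
  modulo the subspace generated by the multilinearity relations.\<close>

definition free_space :: "'x set \<Rightarrow> ('x \<Rightarrow> complex) set" where
  "free_space X = {g. finite {x. g x \<noteq> 0} \<and> {x. g x \<noteq> 0} \<subseteq> X}"

definition multilinear_relations ::
    "'i set \<Rightarrow> ('i \<Rightarrow> ('a \<Rightarrow> complex) set) \<Rightarrow> (('i \<Rightarrow> 'a \<Rightarrow> complex) \<Rightarrow> complex) set" where
  "multilinear_relations I W =
     {basis_vec (x(i := f + g)) - basis_vec (x(i := f)) - basis_vec (x(i := g)) | x i f g.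
        x \<in> (\<Pi>\<^sub>E j\<in>I. W j) \<and> i \<in> I \<and> f \<in> W i \<and> g \<in> W i} \<union>
     {basis_vec (x(i := cscale c f)) - cscale c (basis_vec (x(i := f))) | x i c f.
        x \<in> (\<Pi>\<^sub>E j\<in>I. W j) \<and> i \<in> I \<and> f \<in> W i}"

definition tensor_product ::
    "'i set \<Rightarrow> ('i \<Rightarrow> ('a \<Rightarrow> complex) set) \<Rightarrow> (('i \<Rightarrow> 'a \<Rightarrow> complex) \<Rightarrow> complex) set lin_space" where
  "tensor_product I W =
     quotient_space (free_space (\<Pi>\<^sub>E j\<in>I. W j)) (cfun.span (multilinear_relations I W))"

end

theory Submission
  imports Defs
begin

text \<open>The weight \<open>\<lambda>\<^sub>j\<close> is constant and positive on each \<open>sib\<^sub>j\<close>, so \<open>L\<^sub>u\<^sub>,\<^sub>F\<close> consists of the arrays on the box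
  \<open>\<Prod>\<^sub>j sib(u\<^sub>j)\<close>, \<open>j \<in> F\<close>, whose sums along all axis-parallel lines vanish. Such an array is determined
  by its entries at the positions \<open>\<alpha>\<close> with \<open>\<alpha>\<^sub>j \<noteq> u\<^sub>j\<close> for all \<open>j \<in> F\<close>, and these entries are arbitrary: the
  pure tensors of the vectors \<open>e(\<alpha>\<^sub>j) - e(u\<^sub>j)\<close> are the dual basis. Since \<open>x = (\<Sum>a\<noteq>u\<^sub>j. x(a) (e(a) - e(u\<^sub>j)))\<close> for
  \<open>x \<in> ker X\<^sub>j\<close>, every element of the tensor product is congruent to the combination of these pure
  tensors whose coefficients are the entries of the corresponding array; this inverts the
  evaluation of tensors as arrays.\<close>

section \<open>Finitely supported functions\<close>

lemma sum_fun_apply: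
  fixes h :: "'b \<Rightarrow> 'x \<Rightarrow> complex"
  shows "(\<Sum>y\<in>B. h y) w = (\<Sum>y\<in>B. h y w)"
  by (induction B rule: infinite_finite_induct) auto

lemma cscale_apply [simp]: "cscale c f x = c * f x"
  by (simp add: cscale_def)

lemma finite_l2: "finite A \<Longrightarrow> l2 A = {f. \<forall>x. x \<notin> A \<longrightarrow> f x = 0}"
  by (auto simp: l2_def)

lemma subspace_free_space: "cfun.subspace (free_space X)"
  unfolding cfun.subspace_def
proof (intro conjI ballI allI)
  show "0 \<in> free_space X" by (simp add: free_space_def)
next
  fix f g assume f: "f \<in> free_space X" and g: "g \<in> free_space X"
  have "{x. (f + g) x \<noteq> 0} \<subseteq> {x. f x \<noteq> 0} \<union> {x. g x \<noteq> 0}" by auto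
  then show "f + g \<in> free_space X"
    using f g unfolding free_space_def by (auto intro: finite_subset)
next
  fix c f assume f: "f \<in> free_space X"
  have "{x. cscale c f x \<noteq> 0} \<subseteq> {x. f x \<noteq> 0}" by auto
  then show "cscale c f \<in> free_space X"
    using f unfolding free_space_def by (auto intro: finite_subset)
qed

lemma basis_vec_free_space: "x \<in> X \<Longrightarrow> basis_vec x \<in> free_space X"
  by (simp add: free_space_def basis_vec_def)

lemma free_space_expand:
  assumes "g \<in> free_space X"
  shows "g = (\<Sum>x | g x \<noteq> 0. cscale (g x) (basis_vec x))"
  using assms
  by (auto simp: free_space_def fun_eq_iff sum_fun_apply basis_vec_def if_distrib[of "(*) c" for c]
      cong: if_cong)

text \<open>The linear extension of \<open>basis_vec x \<mapsto> m x\<close>. A function of infinite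
  support gets the default sum 0, so linearity holds only on \<open>free_space\<close>.\<close>

definition lin_ext :: "('x \<Rightarrow> 'y \<Rightarrow> complex) \<Rightarrow> ('x \<Rightarrow> complex) \<Rightarrow> 'y \<Rightarrow> complex" where
  "lin_ext m g = (\<Sum>x | g x \<noteq> 0. cscale (g x) (m x))"

text \<open>Lets functions with different supports be summed over one common finite set, which gives
  additivity.\<close>

lemma lin_ext_superset:
  assumes "finite B" "{x. g x \<noteq> 0} \<subseteq> B"
  shows "lin_ext m g = (\<Sum>x\<in>B. cscale (g x) (m x))"
  unfolding lin_ext_def by (rule sum.mono_neutral_left) (use assms in auto)

lemma lin_ext_add:
  assumes "f \<in> free_space X" "g \<in> free_space X"
  shows "lin_ext m (f + g) = lin_ext m f + lin_ext m g"
proof -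
  let ?B = "{x. f x \<noteq> 0} \<union> {x. g x \<noteq> 0}"
  have fin: "finite ?B" using assms by (auto simp: free_space_def)
  have "lin_ext m (f + g) = (\<Sum>x\<in>?B. cscale ((f + g) x) (m x))"
    by (rule lin_ext_superset[OF fin]) auto
  also have "\<dots> = (\<Sum>x\<in>?B. cscale (f x) (m x)) + (\<Sum>x\<in>?B. cscale (g x) (m x))"
    by (simp add: cfun.scale_left_distrib sum.distrib)
  also have "\<dots> = lin_ext m f + lin_ext m g"
    using lin_ext_superset[OF fin, of f m] lin_ext_superset[OF fin, of g m] by simp
  finally show ?thesis .
qed

lemma lin_ext_scale:
  assumes "f \<in> free_space X"
  shows "lin_ext m (cscale c f) = cscale c (lin_ext m f)"
proof -
  have fin: "finite {x. f x \<noteq> 0}" using assms by (auto simp: free_space_def)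
  show ?thesis
    using lin_ext_superset[OF fin, of "cscale c f" m]
    by (auto simp: lin_ext_def cfun.scale_sum_right cfun.scale_scale)
qed

lemma lin_ext_diff:
  assumes "f \<in> free_space X" "g \<in> free_space X"
  shows "lin_ext m (f - g) = lin_ext m f - lin_ext m g"
proof -
  have "f = (f - g) + g" by simp
  moreover have "f - g \<in> free_space X"
    using assms by (rule cfun.subspace_diff[OF subspace_free_space])
  ultimately show ?thesis
    using lin_ext_add[of "f - g" X g m] assms by (metis add_diff_cancel_right')
qed

lemma lin_ext_sum:
  assumes "\<And>a. a \<in> B \<Longrightarrow> h a \<in> free_space X"
  shows "lin_ext m (\<Sum>a\<in>B. h a) = (\<Sum>a\<in>B. lin_ext m (h a))"
  using assms
proof (induction B rule: infinite_finite_induct)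
  case (insert a B)
  have "(\<Sum>a\<in>B. h a) \<in> free_space X"
    using insert.prems by (intro cfun.subspace_sum[OF subspace_free_space]) auto
  then show ?case
    using insert.IH insert.prems by (simp only: sum.insert[OF insert.hyps(1,2)] lin_ext_add[of _ X] insertI1 insertI2)
qed (simp_all add: lin_ext_def)

lemma lin_ext_basis_vec: "lin_ext m (basis_vec x) = m x"
  by (simp add: lin_ext_def basis_vec_def)

section \<open>Multilinear relations\<close>

lemma PiE_upd: "x \<in> (\<Pi>\<^sub>E j\<in>I. W j) \<Longrightarrow> i \<in> I \<Longrightarrow> f \<in> W i \<Longrightarrow> x(i := f) \<in> (\<Pi>\<^sub>E j\<in>I. W j)"
  by (auto simp: PiE_iff extensional_def)

text \<open>Closure of each \<open>W i\<close> under addition and scaling keeps the updated tuples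
  inside the index set of the free space.\<close>

lemma span_multilinear_relations_free_space:
  assumes W: "\<And>i. i \<in> I \<Longrightarrow> cfun.subspace (W i)"
  shows "cfun.span (multilinear_relations I W) \<subseteq> free_space (\<Pi>\<^sub>E j\<in>I. W j)"
proof (rule cfun.span_minimal[OF _ subspace_free_space])
  let ?X = "free_space (\<Pi>\<^sub>E j\<in>I. W j)"
  have upd: "basis_vec (x(i := f)) \<in> ?X" if "x \<in> (\<Pi>\<^sub>E j\<in>I. W j)" "i \<in> I" "f \<in> W i" for x i f
    using that by (intro basis_vec_free_space PiE_upd)
  show "multilinear_relations I W \<subseteq> ?X"
    unfolding multilinear_relations_def
    by (auto simp del: fun_upd_apply intro!: upd cfun.subspace_diff[OF subspace_free_space]
        cfun.subspace_scale[OF subspace_free_space] cfun.subspace_add[OF W] cfun.subspace_scale[OF W])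
qed

text \<open>The universal property of the tensor product: a multilinear \<open>m\<close> factors
  through the quotient. Multilinearity is asked for arbitrary tuples, as a product formula provides
  it.\<close>

lemma lin_ext_relations:
  assumes W: "\<And>i. i \<in> I \<Longrightarrow> cfun.subspace (W i)"
    and add: "\<And>x i f g. i \<in> I \<Longrightarrow> m (x(i := f + g)) = m (x(i := f)) + m (x(i := g))"
    and scale: "\<And>x i c f. i \<in> I \<Longrightarrow> m (x(i := cscale c f)) = cscale c (m (x(i := f)))"
    and g: "g \<in> cfun.span (multilinear_relations I W)"
  shows "lin_ext m g = 0"
proof -
  let ?X = "free_space (\<Pi>\<^sub>E j\<in>I. W j)"
  have sub: "cfun.subspace {g \<in> ?X. lin_ext m g = 0}"
    using subspace_free_space[of "\<Pi>\<^sub>E j\<in>I. W j"]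
    unfolding cfun.subspace_def
    by (auto simp: lin_ext_add lin_ext_scale) (simp add: lin_ext_def)
  have "g \<in> ?X \<and> lin_ext m g = 0" if r: "g \<in> multilinear_relations I W" for g
  proof
    show "g \<in> ?X"
      using r span_multilinear_relations_free_space[of I W] W cfun.span_base by blast
    \<comment> \<open>With \<open>X = UNIV\<close> the side conditions become trivial: no tuple has
      to be placed in the product of the \<open>W j\<close>.\<close>
    note ext = lin_ext_diff[where X = UNIV] lin_ext_scale[where X = UNIV] lin_ext_basis_vec
      cfun.subspace_diff[OF subspace_free_space] cfun.subspace_scale[OF subspace_free_space]
      basis_vec_free_space UNIV_I
    from r consider
        (add) x i f h where "i \<in> I"
          "g = basis_vec (x(i := f + h)) - basis_vec (x(i := f)) - basis_vec (x(i := h))"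
      | (scale) x i c f where "i \<in> I"
          "g = basis_vec (x(i := cscale c f)) - cscale c (basis_vec (x(i := f)))"
      unfolding multilinear_relations_def by blast
    then show "lin_ext m g = 0"
    proof cases
      case add
      then show ?thesis by (simp only: ext assms(2)) (simp only: add_diff_cancel_left' diff_self)
    next
      case scale
      then show ?thesis by (simp only: ext assms(3) diff_self)
    qed
  qed
  then have "multilinear_relations I W \<subseteq> {g \<in> ?X. lin_ext m g = 0}" by blast
  then show ?thesis
    using cfun.span_minimal[OF _ sub] g by blast
qed

text \<open>The additivity and homogeneity relations combine, by induction on \<open>B\<close>, to
  linearity in one slot.\<close>

lemma basis_vec_sum_slot:
  assumes W: "cfun.subspace (W i)" and x: "x \<in> (\<Pi>\<^sub>E j\<in>I. W j)" and i: "i \<in> I"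
    and "finite B" "\<And>a. a \<in> B \<Longrightarrow> h a \<in> W i"
  shows "basis_vec (x(i := \<Sum>a\<in>B. cscale (c a) (h a))) - (\<Sum>a\<in>B. cscale (c a) (basis_vec (x(i := h a))))
    \<in> cfun.span (multilinear_relations I W)" (is "_ \<in> ?N")
  using assms(4,5)
proof (induction B)
  case empty
  \<comment> \<open>Homogeneity with scalar 0 makes a tuple with a zero slot congruent to
    zero.\<close>
  have "basis_vec (x(i := cscale 0 0)) - cscale 0 (basis_vec (x(i := 0))) \<in> ?N"
    using x i cfun.subspace_0[OF W] unfolding multilinear_relations_def
    by (intro cfun.span_base UnI2) blast
  then have "basis_vec (x(i := \<Sum>a\<in>{}. cscale (c a) (h a)))
      - (\<Sum>a\<in>{}. cscale (c a) (basis_vec (x(i := h a)))) \<in> ?N"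
    by simp
  then show ?case .
next
  case (insert a B)
  let ?s = "\<Sum>a\<in>B. cscale (c a) (h a)"
  have s: "?s \<in> W i" and ca: "cscale (c a) (h a) \<in> W i"
    using insert.prems by (auto intro!: cfun.subspace_sum[OF W] cfun.subspace_scale[OF W])
  \<comment> \<open>Three congruences that telescope: split off the summand of \<open>a\<close>,
    pull out its scalar, expand the rest.\<close>
  have 1: "basis_vec (x(i := cscale (c a) (h a) + ?s)) - basis_vec (x(i := cscale (c a) (h a)))
      - basis_vec (x(i := ?s)) \<in> ?N"
    using x i s ca unfolding multilinear_relations_def
    by (intro cfun.span_base UnI1) blast
  have 2: "basis_vec (x(i := cscale (c a) (h a))) - cscale (c a) (basis_vec (x(i := h a))) \<in> ?N"
    using x i insert.prems unfolding multilinear_relations_def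
    by (intro cfun.span_base UnI2) blast
  have 3: "basis_vec (x(i := ?s)) - (\<Sum>a\<in>B. cscale (c a) (basis_vec (x(i := h a)))) \<in> ?N"
    by (rule insert.IH) (use insert.prems in auto)
  have "basis_vec (x(i := \<Sum>a\<in>insert a B. cscale (c a) (h a)))
      - (\<Sum>a\<in>insert a B. cscale (c a) (basis_vec (x(i := h a)))) \<in> ?N"
    using cfun.span_add[OF cfun.span_add[OF 1 2] 3] insert.hyps by (simp add: algebra_simps)
  then show ?case .
qed

section \<open>Boxes of points with prescribed values off the index set\<close>

definition pbox :: "'i set \<Rightarrow> ('i \<Rightarrow> 'a set) \<Rightarrow> ('i \<Rightarrow> 'a) \<Rightarrow> ('i \<Rightarrow> 'a) set" where
  "pbox I A u = {w. (\<forall>i\<in>I. w i \<in> A i) \<and> (\<forall>i. i \<notin> I \<longrightarrow> w i = u i)}"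

lemma pbox_upd: "w \<in> pbox I A u \<Longrightarrow> i \<in> I \<Longrightarrow> a \<in> A i \<Longrightarrow> w(i := a) \<in> pbox I A u"
  by (auto simp: pbox_def)

text \<open>Off \<open>I\<close> a point carries the fixed values of \<open>u\<close>, so
  restriction to \<open>I\<close> loses nothing; finiteness and cardinality are inherited from
  \<open>PiE\<close>.\<close>

lemma bij_betw_pbox_PiE: "bij_betw (\<lambda>w. restrict w I) (pbox I A u) (\<Pi>\<^sub>E i\<in>I. A i)"
proof (rule bij_betw_byWitness[where f' = "\<lambda>g. override_on u g I"])
  show "\<forall>w\<in>pbox I A u. override_on u (restrict w I) I = w"
    by (auto simp: pbox_def override_on_def fun_eq_iff)
  show "\<forall>g\<in>\<Pi>\<^sub>E i\<in>I. A i. restrict (override_on u g I) I = g"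
    by (auto simp: override_on_def fun_eq_iff PiE_iff extensional_def)
qed (auto simp: pbox_def override_on_def)

lemma finite_pbox: "finite I \<Longrightarrow> (\<And>i. i \<in> I \<Longrightarrow> finite (A i)) \<Longrightarrow> finite (pbox I A u)"
  using bij_betw_finite[OF bij_betw_pbox_PiE] finite_PiE by blast

lemma card_pbox: "finite I \<Longrightarrow> card (pbox I A u) = (\<Prod>i\<in>I. card (A i))"
  using bij_betw_same_card[OF bij_betw_pbox_PiE] card_PiE by metis

text \<open>A point of the smaller box has \<open>u k\<close> in slot \<open>k\<close>, so resetting
  this slot inverts the update.\<close>

lemma sum_pbox_insert:
  assumes "k \<notin> J"
  shows "(\<Sum>\<alpha>\<in>pbox (insert k J) A u. h \<alpha>) = (\<Sum>\<alpha>\<in>pbox J A u. \<Sum>a\<in>A k. h (\<alpha>(k := a)))"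
proof -
  have "bij_betw (\<lambda>(\<alpha>, a). \<alpha>(k := a)) (pbox J A u \<times> A k) (pbox (insert k J) A u)"
  proof (rule bij_betw_byWitness[where f' = "\<lambda>\<alpha>. (\<alpha>(k := u k), \<alpha> k)"])
  qed (use assms in \<open>auto simp: pbox_def fun_eq_iff\<close>)
  from sum.reindex_bij_betw[OF this, of h] show ?thesis
    by (simp add: sum.cartesian_product case_prod_beta)
qed

text \<open>Slots are expanded one at a time: those in \<open>J\<close> already hold a vector
  \<open>h i (\<alpha> i)\<close>, the others still hold \<open>x i\<close>. The full expansion is
  the case \<open>J = I\<close>.\<close>

lemma basis_vec_multilinear_expansion:
  assumes W: "\<And>i. i \<in> I \<Longrightarrow> cfun.subspace (W i)" and x: "x \<in> (\<Pi>\<^sub>E j\<in>I. W j)"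
    and B: "\<And>i. i \<in> I \<Longrightarrow> finite (B i)"
    and h: "\<And>i a. i \<in> I \<Longrightarrow> a \<in> B i \<Longrightarrow> h i a \<in> W i"
    and xh: "\<And>i. i \<in> I \<Longrightarrow> x i = (\<Sum>a\<in>B i. cscale (c i a) (h i a))"
    and "finite J" "J \<subseteq> I"
  shows "basis_vec x - (\<Sum>\<alpha>\<in>pbox J B u. cscale (\<Prod>j\<in>J. c j (\<alpha> j))
      (basis_vec (\<lambda>i. if i \<in> J then h i (\<alpha> i) else x i)))
    \<in> cfun.span (multilinear_relations I W)" (is "_ \<in> ?N")
  using assms(6,7)
proof (induction J)
  case empty
  have "pbox {} B u = {u}" by (auto simp: pbox_def)
  then have "basis_vec x - (\<Sum>\<alpha>\<in>pbox {} B u. cscale (\<Prod>j\<in>{}. c j (\<alpha> j))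
      (basis_vec (\<lambda>i. if i \<in> {} then h i (\<alpha> i) else x i))) \<in> ?N"
    by (simp add: cfun.span_zero)
  then show ?case .
next
  case (insert k J)
  define y where "y J \<alpha> = (\<lambda>i. if i \<in> J then h i (\<alpha> i) else x i)" for J \<alpha>
  define C where "C \<alpha> = (\<Prod>j\<in>J. c j (\<alpha> j))" for \<alpha>
  have k: "k \<in> I" using insert.prems by blast
  have "basis_vec (y J \<alpha>) - (\<Sum>a\<in>B k. cscale (c k a) (basis_vec (y (insert k J) (\<alpha>(k := a))))) \<in> ?N"
    if \<alpha>: "\<alpha> \<in> pbox J B u" for \<alpha>
  proof -
    have "y J \<alpha> \<in> (\<Pi>\<^sub>E j\<in>I. W j)"
      using x \<alpha> insert.prems h by (auto simp: y_def pbox_def PiE_iff extensional_def)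
    from basis_vec_sum_slot[OF W[OF k] this k B[OF k] h[OF k], of "\<lambda>a. a" "c k"]
    have "basis_vec ((y J \<alpha>)(k := x k)) - (\<Sum>a\<in>B k. cscale (c k a) (basis_vec ((y J \<alpha>)(k := h k a)))) \<in> ?N"
      using xh[OF k] by simp
    moreover have "(y J \<alpha>)(k := x k) = y J \<alpha>"
      using insert.hyps by (auto simp: y_def)
    moreover have "(y J \<alpha>)(k := h k a) = y (insert k J) (\<alpha>(k := a))" for a
      using insert.hyps by (auto simp: y_def fun_eq_iff)
    ultimately show ?thesis by simp
  qed
  \<comment> \<open>The one-slot congruences, weighted by the coefficients reached so far, add up
    over the box.\<close>
  then have "(\<Sum>\<alpha>\<in>pbox J B u. cscale (C \<alpha>) (basis_vec (y J \<alpha>)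
      - (\<Sum>a\<in>B k. cscale (c k a) (basis_vec (y (insert k J) (\<alpha>(k := a))))))) \<in> ?N"
    by (intro cfun.span_sum cfun.span_scale)
  moreover have "(\<Prod>j\<in>insert k J. c j ((\<alpha>(k := a)) j)) = C \<alpha> * c k a" for \<alpha> a
  proof -
    have "(\<Prod>j\<in>J. c j ((\<alpha>(k := a)) j)) = C \<alpha>"
      unfolding C_def using insert.hyps by (intro prod.cong) auto
    then show ?thesis using insert.hyps by simp
  qed
  ultimately have "(\<Sum>\<alpha>\<in>pbox J B u. cscale (C \<alpha>) (basis_vec (y J \<alpha>)))
      - (\<Sum>\<alpha>\<in>pbox (insert k J) B u. cscale (\<Prod>j\<in>insert k J. c j (\<alpha> j)) (basis_vec (y (insert k J) \<alpha>))) \<in> ?N"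
    unfolding sum_pbox_insert[OF insert.hyps(2)]
    by (simp only: cfun.scale_right_diff_distrib sum_subtractf cfun.scale_sum_right cfun.scale_scale)
  moreover have "basis_vec x - (\<Sum>\<alpha>\<in>pbox J B u. cscale (C \<alpha>) (basis_vec (y J \<alpha>))) \<in> ?N"
    unfolding y_def C_def by (rule insert.IH) (use insert.prems in auto)
  ultimately have "basis_vec x - (\<Sum>\<alpha>\<in>pbox (insert k J) B u.
      cscale (\<Prod>j\<in>insert k J. c j (\<alpha> j)) (basis_vec (y (insert k J) \<alpha>))) \<in> ?N"
    using cfun.span_add by fastforce
  then show ?case unfolding y_def .
qed

section \<open>Arrays with vanishing line sums\<close>

text \<open>For finite \<open>A\<close> this is the kernel of the summation functional on
  \<open>l2 A\<close>; square summability is then automatic.\<close>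

definition zero_sum :: "'a set \<Rightarrow> ('a \<Rightarrow> complex) set" where
  "zero_sum A = {f. (\<forall>x. x \<notin> A \<longrightarrow> f x = 0) \<and> (\<Sum>x\<in>A. f x) = 0}"

lemma sum_cscale: "(\<Sum>x\<in>B. cscale c f (p x)) = c * (\<Sum>x\<in>B. f (p x))"
  by (simp add: sum_distrib_left)

lemma subspace_zero_sum: "cfun.subspace (zero_sum A)"
  unfolding cfun.subspace_def zero_sum_def
  by (auto simp: sum.distrib sum_cscale simp del: cscale_apply) simp

definition zero_line_sums ::
    "'i set \<Rightarrow> ('i \<Rightarrow> 'a set) \<Rightarrow> ('i \<Rightarrow> 'a) \<Rightarrow> (('i \<Rightarrow> 'a) \<Rightarrow> complex) set" where
  "zero_line_sums I A u = {f. (\<forall>w. w \<notin> pbox I A u \<longrightarrow> f w = 0) \<and>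
     (\<forall>i\<in>I. \<forall>w\<in>pbox I A u. (\<Sum>a\<in>A i. f (w(i := a))) = 0)}"

lemma subspace_zero_line_sums: "cfun.subspace (zero_line_sums I A u)"
  unfolding cfun.subspace_def zero_line_sums_def
  by (auto simp: sum.distrib sum_cscale simp del: cscale_apply fun_upd_apply) simp

text \<open>The product ignores coordinates off \<open>I\<close>; the cut-off removes points that
  differ from \<open>u\<close> there.\<close>

definition pure_tensor ::
    "'i set \<Rightarrow> ('i \<Rightarrow> 'a set) \<Rightarrow> ('i \<Rightarrow> 'a) \<Rightarrow> ('i \<Rightarrow> 'a \<Rightarrow> complex) \<Rightarrow> ('i \<Rightarrow> 'a) \<Rightarrow> complex" where
  "pure_tensor I A u x = (\<lambda>w. if w \<in> pbox I A u then \<Prod>i\<in>I. x i (w i) else 0)"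

text \<open>Isolating the factor of slot \<open>i\<close> makes the dependence on \<open>f\<close>
  visibly linear.\<close>

lemma prod_upd_slot:
  assumes "finite I" "i \<in> I"
  shows "(\<Prod>j\<in>I. (x(i := f)) j (w j)) = f (w i) * (\<Prod>j\<in>I - {i}. x j (w j))"
proof -
  have "(\<Prod>j\<in>I - {i}. (x(i := f)) j (w j)) = (\<Prod>j\<in>I - {i}. x j (w j))"
    by (intro prod.cong) auto
  then show ?thesis by (simp add: prod.remove[OF assms])
qed

lemma pure_tensor_add:
  "finite I \<Longrightarrow> i \<in> I \<Longrightarrow>
    pure_tensor I A u (x(i := f + g)) = pure_tensor I A u (x(i := f)) + pure_tensor I A u (x(i := g))"
  by (simp add: fun_eq_iff pure_tensor_def prod_upd_slot distrib_right del: fun_upd_apply)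

lemma pure_tensor_scale:
  "finite I \<Longrightarrow> i \<in> I \<Longrightarrow>
    pure_tensor I A u (x(i := cscale c f)) = cscale c (pure_tensor I A u (x(i := f)))"
  by (simp add: fun_eq_iff pure_tensor_def prod_upd_slot mult.assoc del: fun_upd_apply)

text \<open>Along a line in direction \<open>i\<close> only the factor \<open>x i a\<close> varies,
  and its sum over \<open>A i\<close> is zero.\<close>

lemma pure_tensor_zero_line_sums:
  assumes "finite I" and x: "\<And>i. i \<in> I \<Longrightarrow> x i \<in> zero_sum (A i)"
  shows "pure_tensor I A u x \<in> zero_line_sums I A u"
proof -
  have "(\<Sum>a\<in>A i. pure_tensor I A u x (w(i := a))) = 0" if i: "i \<in> I" and w: "w \<in> pbox I A u" for i w
  proof -
    have "pure_tensor I A u x (w(i := a)) = x i a * (\<Prod>j\<in>I - {i}. x j (w j))" if "a \<in> A i" for a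
    proof -
      have "(\<Prod>j\<in>I - {i}. x j ((w(i := a)) j)) = (\<Prod>j\<in>I - {i}. x j (w j))"
        by (intro prod.cong) auto
      then show ?thesis
        using pbox_upd[OF w i that] by (simp add: pure_tensor_def prod.remove[OF assms(1) i])
    qed
    then show ?thesis
      using x[OF i] by (simp add: zero_sum_def flip: sum_distrib_right)
  qed
  then show ?thesis by (simp add: zero_line_sums_def pure_tensor_def)
qed

text \<open>Solving the line equation in direction \<open>i\<close> for the entry with \<open>w i = u i\<close> expresses
  the entry through entries having fewer coordinates in common with \<open>u\<close>.\<close>

lemma zero_line_sums_determined:
  assumes I: "finite I" and A: "\<And>i. i \<in> I \<Longrightarrow> finite (A i)" and u: "\<And>i. i \<in> I \<Longrightarrow> u i \<in> A i"
    and f: "f \<in> zero_line_sums I A u"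
    and z: "\<And>\<alpha>. \<alpha> \<in> pbox I (\<lambda>i. A i - {u i}) u \<Longrightarrow> f \<alpha> = 0"
  shows "f = 0"
proof -
  have "f w = 0" if "w \<in> pbox I A u" for w
    using that
  proof (induction "card {i \<in> I. w i = u i}" arbitrary: w rule: less_induct)
    case less
    show ?case
    proof (cases "\<exists>i\<in>I. w i = u i")
      case False
      then show ?thesis using less.prems by (intro z) (auto simp: pbox_def)
    next
      case True
      then obtain i where i: "i \<in> I" "w i = u i" by blast
      have "f (w(i := a)) = 0" if a: "a \<in> A i - {u i}" for a
      proof (rule less.hyps)
        have "{j \<in> I. (w(i := a)) j = u j} \<subset> {j \<in> I. w j = u j}"
          using a i by auto
        then show "card {j \<in> I. (w(i := a)) j = u j} < card {j \<in> I. w j = u j}"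
          using I by (intro psubset_card_mono) auto
        show "w(i := a) \<in> pbox I A u"
          using a i less.prems by (intro pbox_upd) auto
      qed
      then have "(\<Sum>a\<in>A i. f (w(i := a))) = f (w(i := u i))"
        by (simp add: sum.remove[OF A[OF i(1)] u[OF i(1)]])
      moreover have "w(i := u i) = w" using i by auto
      moreover have "(\<Sum>a\<in>A i. f (w(i := a))) = 0"
        using f i less.prems by (simp add: zero_line_sums_def)
      ultimately show ?thesis by simp
    qed
  qed
  then show ?thesis using f by (auto simp: zero_line_sums_def fun_eq_iff)
qed

section \<open>The isomorphism\<close>

locale pointed_box =
  fixes I :: "'i set" and A :: "'i \<Rightarrow> 'a set" and u :: "'i \<Rightarrow> 'a"
  assumes finite_I: "finite I" and finite_A: "\<And>i. i \<in> I \<Longrightarrow> finite (A i)"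
    and base: "\<And>i. i \<in> I \<Longrightarrow> u i \<in> A i"
begin

text \<open>\<open>slots\<close> are the positions of the free entries; \<open>synth\<close> sends an array to a representative of the
  corresponding tensor, and \<open>ev\<close> evaluates representatives as arrays.\<close>

definition slots :: "('i \<Rightarrow> 'a) set" where
  "slots = pbox I (\<lambda>i. A i - {u i}) u"

text \<open>Restricted to \<open>I\<close> to be an extensional tuple, as the indices of the free
  space are.\<close>

definition diff_basis :: "('i \<Rightarrow> 'a) \<Rightarrow> 'i \<Rightarrow> 'a \<Rightarrow> complex" where
  "diff_basis \<alpha> = (\<lambda>i\<in>I. basis_vec (\<alpha> i) - basis_vec (u i))"

definition W :: "'i \<Rightarrow> ('a \<Rightarrow> complex) set" where
  "W = (\<lambda>i. zero_sum (A i))"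

definition N :: "(('i \<Rightarrow> 'a \<Rightarrow> complex) \<Rightarrow> complex) set" where
  "N = cfun.span (multilinear_relations I W)"

definition synth :: "(('i \<Rightarrow> 'a) \<Rightarrow> complex) \<Rightarrow> ('i \<Rightarrow> 'a \<Rightarrow> complex) \<Rightarrow> complex" where
  "synth f = (\<Sum>\<alpha>\<in>slots. cscale (f \<alpha>) (basis_vec (diff_basis \<alpha>)))"

abbreviation ev :: "(('i \<Rightarrow> 'a \<Rightarrow> complex) \<Rightarrow> complex) \<Rightarrow> ('i \<Rightarrow> 'a) \<Rightarrow> complex" where
  "ev \<equiv> lin_ext (pure_tensor I A u)"

abbreviation L :: "(('i \<Rightarrow> 'a) \<Rightarrow> complex) set" where
  "L \<equiv> zero_line_sums I A u"

abbreviation Free :: "(('i \<Rightarrow> 'a \<Rightarrow> complex) \<Rightarrow> complex) set" where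
  "Free \<equiv> free_space (\<Pi>\<^sub>E j\<in>I. W j)"

lemma finite_slots: "finite slots"
  unfolding slots_def using finite_I finite_A by (intro finite_pbox) auto

text \<open>Each coordinate loses exactly the value \<open>u i\<close>; over the integers the
  subtraction is not truncated.\<close>

lemma card_slots: "int (card slots) = (\<Prod>i\<in>I. int (card (A i)) - 1)"
proof -
  have "int (card (A i - {u i})) = int (card (A i)) - 1" if "i \<in> I" for i
  proof -
    have "card (A i) = Suc (card (A i - {u i}))"
      using card.remove[OF finite_A[OF that] base[OF that]] .
    then show ?thesis by simp
  qed
  then show ?thesis by (simp add: slots_def card_pbox[OF finite_I])
qed

lemma slots_subset: "slots \<subseteq> pbox I A u"
  by (auto simp: slots_def pbox_def)

lemma subspace_W: "cfun.subspace (W i)"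
  by (simp add: W_def subspace_zero_sum)

lemma diff_in_W:
  assumes "i \<in> I" "a \<in> A i"
  shows "basis_vec a - basis_vec (u i) \<in> W i"
  using assms base finite_A by (auto simp: W_def zero_sum_def basis_vec_def sum_subtractf)

lemma diff_basis_PiE: "\<alpha> \<in> slots \<Longrightarrow> diff_basis \<alpha> \<in> (\<Pi>\<^sub>E j\<in>I. W j)"
  using slots_subset diff_in_W by (auto simp: diff_basis_def pbox_def)

text \<open>Zero total sum forces \<open>f (u i)\<close> to be minus the sum of the other entries,
  which is the coefficient of \<open>basis_vec (u i)\<close> on the right.\<close>

lemma W_expand:
  assumes i: "i \<in> I" and f: "f \<in> W i"
  shows "f = (\<Sum>a\<in>A i - {u i}. cscale (f a) (basis_vec a - basis_vec (u i)))"
proof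
  fix b
  have eq: "(\<Sum>a\<in>A i - {u i}. cscale (f a) (basis_vec a - basis_vec (u i))) b
      = (if b \<in> A i - {u i} then f b else 0) - (if b = u i then \<Sum>a\<in>A i - {u i}. f a else 0)"
    using finite_A[OF i]
    by (simp add: sum_fun_apply basis_vec_def right_diff_distrib sum_subtractf
        if_distrib[of "(*) c" for c] cong: if_cong)
  have "f (u i) + (\<Sum>a\<in>A i - {u i}. f a) = 0"
    using f sum.remove[OF finite_A[OF i] base[OF i], of f] by (simp add: W_def zero_sum_def)
  then have "f (u i) = - (\<Sum>a\<in>A i - {u i}. f a)" by (simp add: eq_neg_iff_add_eq_0)
  then show "f b = (\<Sum>a\<in>A i - {u i}. cscale (f a) (basis_vec a - basis_vec (u i))) b"
    unfolding eq using f by (auto simp: W_def zero_sum_def)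
qed

section \<open>Evaluation and synthesis, inverse to each other modulo the relations\<close>

lemma N_subspace: "cfun.subspace N"
  by (simp add: N_def)

lemma ev_N: "g \<in> N \<Longrightarrow> ev g = 0"
  unfolding N_def
  by (rule lin_ext_relations[where I = I and W = W])
    (assumption | rule subspace_W pure_tensor_add[OF finite_I] pure_tensor_scale[OF finite_I])+

lemma ev_L:
  assumes "g \<in> Free"
  shows "ev g \<in> L"
  unfolding lin_ext_def
proof (intro cfun.subspace_sum[OF subspace_zero_line_sums] cfun.subspace_scale[OF subspace_zero_line_sums])
  fix x assume "x \<in> {x. g x \<noteq> 0}"
  then have "x \<in> (\<Pi>\<^sub>E j\<in>I. W j)" using assms by (auto simp: free_space_def)
  then show "pure_tensor I A u x \<in> L"
    using finite_I by (intro pure_tensor_zero_line_sums) (auto simp: W_def)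
qed

lemma synth_Free: "synth f \<in> Free"
  unfolding synth_def
  by (intro cfun.subspace_sum[OF subspace_free_space] cfun.subspace_scale[OF subspace_free_space]
      basis_vec_free_space diff_basis_PiE)

lemma synth_add: "synth (f + g) = synth f + synth g"
  by (simp add: synth_def cfun.scale_left_distrib sum.distrib)

lemma synth_scale: "synth (cscale c f) = cscale c (synth f)"
  by (simp add: synth_def cfun.scale_sum_right cfun.scale_scale)

lemma ev_synth: "ev (synth f) = (\<Sum>\<alpha>\<in>slots. cscale (f \<alpha>) (pure_tensor I A u (diff_basis \<alpha>)))"
  unfolding synth_def
  by (subst lin_ext_sum[where X = UNIV])
    (auto simp: lin_ext_scale[where X = UNIV] lin_ext_basis_vec basis_vec_free_space
      intro!: cfun.subspace_scale[OF subspace_free_space])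

text \<open>At a slot position \<beta> every \<open>\<beta> i\<close> with \<open>i\<close> in
  \<open>I\<close> differs from \<open>u i\<close>, so the \<open>basis_vec (u i)\<close> parts
  vanish and each factor is a Kronecker delta.\<close>

lemma pure_tensor_diff_basis:
  assumes \<alpha>: "\<alpha> \<in> slots" and \<beta>: "\<beta> \<in> slots"
  shows "pure_tensor I A u (diff_basis \<alpha>) \<beta> = (if \<alpha> = \<beta> then 1 else 0)"
proof -
  have 1: "pure_tensor I A u (diff_basis \<alpha>) \<beta> = (\<Prod>i\<in>I. if \<beta> i = \<alpha> i then 1 else 0)"
    using \<beta> slots_subset
    by (auto simp: pure_tensor_def diff_basis_def basis_vec_def slots_def pbox_def intro!: prod.cong)
  show ?thesis
  proof (cases "\<alpha> = \<beta>")
    case False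
    then obtain i where "\<alpha> i \<noteq> \<beta> i" by blast
    moreover from this have "i \<in> I"
      using \<alpha> \<beta> by (auto simp: slots_def pbox_def)
    ultimately have "(\<Prod>i\<in>I. if \<beta> i = \<alpha> i then 1 else (0 :: complex)) = 0"
      using finite_I by (intro prod_zero) (auto intro!: bexI[of _ i])
    with 1 False show ?thesis by simp
  next
    case True
    then show ?thesis by (subst 1) simp
  qed
qed

lemma ev_synth_slots: "\<beta> \<in> slots \<Longrightarrow> ev (synth f) \<beta> = f \<beta>"
  using finite_slots
  by (simp add: ev_synth sum_fun_apply pure_tensor_diff_basis if_distrib[of "(*) c" for c]
      cong: if_cong)

lemma L_eqI:
  assumes "f \<in> L" "g \<in> L" "\<And>\<alpha>. \<alpha> \<in> slots \<Longrightarrow> f \<alpha> = g \<alpha>"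
  shows "f = g"
proof -
  have "f - g = 0"
    using assms finite_I finite_A base
    by (intro zero_line_sums_determined[of I A u] cfun.subspace_diff[OF subspace_zero_line_sums])
      (auto simp: slots_def)
  then show ?thesis by simp
qed

text \<open>Both sides lie in \<open>L\<close> and have the same free entries.\<close>

lemma ev_synth_L: "f \<in> L \<Longrightarrow> ev (synth f) = f"
  by (rule L_eqI) (auto simp: ev_L synth_Free ev_synth_slots)

text \<open>The full expansion with coefficients \<open>x j (\<alpha> j)\<close>, whose product is
  the entry of the pure tensor at \<alpha>.\<close>

lemma synth_ev_basis_vec:
  assumes x: "x \<in> (\<Pi>\<^sub>E j\<in>I. W j)"
  shows "basis_vec x - synth (pure_tensor I A u x) \<in> N"
proof -
  let ?h = "\<lambda>i a. basis_vec a - basis_vec (u i)"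
  have "basis_vec x - (\<Sum>\<alpha>\<in>slots. cscale (\<Prod>j\<in>I. x j (\<alpha> j))
      (basis_vec (\<lambda>i. if i \<in> I then ?h i (\<alpha> i) else x i))) \<in> N"
    unfolding N_def slots_def using x finite_I finite_A
    by (intro basis_vec_multilinear_expansion subspace_W W_expand diff_in_W) auto
  moreover have "(\<lambda>i. if i \<in> I then ?h i (\<alpha> i) else x i) = diff_basis \<alpha>" for \<alpha>
    using x by (auto simp: diff_basis_def fun_eq_iff PiE_iff extensional_def)
  moreover have "synth (pure_tensor I A u x)
      = (\<Sum>\<alpha>\<in>slots. cscale (\<Prod>j\<in>I. x j (\<alpha> j)) (basis_vec (diff_basis \<alpha>)))"
    unfolding synth_def using slots_subset by (intro sum.cong) (auto simp: pure_tensor_def)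
  ultimately show ?thesis by simp
qed

lemma synth_sum: "synth (\<Sum>x\<in>B. h x) = (\<Sum>x\<in>B. synth (h x))"
proof (induction B rule: infinite_finite_induct)
  case (insert a B)
  have "synth (\<Sum>x\<in>insert a B. h x) = synth (h a) + synth (\<Sum>x\<in>B. h x)"
    using insert.hyps by (simp add: synth_add)
  then show ?case
    by (simp only: insert.IH sum.insert[OF insert.hyps])
qed (simp_all add: synth_def)

text \<open>A linear combination of the congruences for single tuples; it yields surjectivity of the
  coset map on \<open>L\<close>.\<close>

lemma synth_ev:
  assumes "g \<in> Free"
  shows "g - synth (ev g) \<in> N"
proof -
  have "(\<Sum>x | g x \<noteq> 0. cscale (g x) (basis_vec x - synth (pure_tensor I A u x))) \<in> N"
    using assms
    by (intro cfun.subspace_sum[OF N_subspace] cfun.subspace_scale[OF N_subspace] synth_ev_basis_vec)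
      (auto simp: free_space_def)
  also have "(\<Sum>x | g x \<noteq> 0. cscale (g x) (basis_vec x - synth (pure_tensor I A u x)))
      = (\<Sum>x | g x \<noteq> 0. cscale (g x) (basis_vec x)) - synth (ev g)"
    by (simp add: lin_ext_def synth_sum synth_scale cfun.scale_right_diff_distrib sum_subtractf)
  also have "(\<Sum>x | g x \<noteq> 0. cscale (g x) (basis_vec x)) = g"
    using free_space_expand[OF assms] by simp
  finally show ?thesis .
qed

section \<open>Coset arithmetic\<close>

lemma coset_eq_iff: "f +o N = g +o N \<longleftrightarrow> f - g \<in> N"
proof
  assume "f +o N = g +o N"
  moreover have "f \<in> f +o N"
    using cfun.subspace_0[OF N_subspace] by (metis add.right_neutral set_plus_intro2)
  ultimately have "f \<in> g +o N" by simp
  then show "f - g \<in> N" by (auto simp: elt_set_plus_def)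
next
  assume *: "f - g \<in> N"
  have sub: "f +o N \<subseteq> g +o N" if "f - g \<in> N" for f g
  proof
    fix x assume "x \<in> f +o N"
    then obtain n where n: "n \<in> N" "x = f + n" by (auto simp: elt_set_plus_def)
    then have "x = g + ((f - g) + n)" by simp
    then show "x \<in> g +o N"
      using cfun.subspace_add[OF N_subspace that n(1)] by (metis set_plus_intro2)
  qed
  have "g - f \<in> N" using cfun.subspace_neg[OF N_subspace *] by simp
  then show "f +o N = g +o N" using sub * by blast
qed

lemma N_plus_N: "N + N = N"
proof
  show "N + N \<subseteq> N"
    using cfun.subspace_add[OF N_subspace] by (auto simp: set_plus_def)
  show "N \<subseteq> N + N"
    using set_plus_intro[OF cfun.subspace_0[OF N_subspace]] by fastforce
qed

lemma coset_add: "(f +o N) + (g +o N) = (f + g) +o N"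
  by (metis N_plus_N set_plus_rearrange)

lemma coset_scale: "cscale c ` (f +o N) + N = cscale c f +o N"
proof (intro set_eqI iffI)
  fix x assume "x \<in> cscale c ` (f +o N) + N"
  then obtain n m where "n \<in> N" "m \<in> N" "x = cscale c (f + n) + m"
    by (auto simp: set_plus_def elt_set_plus_def)
  then show "x \<in> cscale c f +o N"
    using cfun.subspace_add[OF N_subspace] cfun.subspace_scale[OF N_subspace]
    by (auto simp: elt_set_plus_def cfun.scale_right_distrib add.assoc)
next
  fix x assume "x \<in> cscale c f +o N"
  then obtain n where n: "n \<in> N" "x = cscale c f + n" by (auto simp: elt_set_plus_def)
  \<comment> \<open>The image contributes \<open>cscale c f\<close>, while \<open>n\<close> comes
    from the added copy of \<open>N\<close>; this also covers \<open>c = 0\<close>.\<close>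
  have "f \<in> f +o N"
    using cfun.subspace_0[OF N_subspace] by (metis add.right_neutral set_plus_intro2)
  then show "x \<in> cscale c ` (f +o N) + N"
    using n by (auto simp: set_plus_def)
qed

section \<open>Isomorphism, finite dimensionality and dimension\<close>

lemma tensor_simps:
  "pts (tensor_product I W) = (\<lambda>x. x +o N) ` Free"
  "vadd (tensor_product I W) = (+)"
  "vscale (tensor_product I W) = (\<lambda>c A. cscale c ` A + N)"
  by (simp_all add: tensor_product_def quotient_space_def N_def)

lemma pts_tensor: "pts (tensor_product I W) = (\<lambda>f. synth f +o N) ` L"
proof -
  have "g +o N = synth (ev g) +o N" if "g \<in> Free" for g
    using synth_ev[OF that] by (simp add: coset_eq_iff)
  then show ?thesis
    unfolding tensor_simps using ev_L synth_Free by blast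
qed

text \<open>The map is \<open>synth\<close> followed by passage to cosets: surjective by
  \<open>pts_tensor\<close>, injective because \<open>ev\<close> kills \<open>N\<close> and inverts
  \<open>synth\<close> on \<open>L\<close>.\<close>

lemma lin_isomorphic_tensor: "lin_isomorphic (as_space L) (tensor_product I W)"
  unfolding lin_isomorphic_def
proof (intro exI[of _ "\<lambda>f. synth f +o N"] conjI ballI allI)
  show "bij_betw (\<lambda>f. synth f +o N) (pts (as_space L)) (pts (tensor_product I W))"
  proof (rule bij_betw_imageI)
    show "inj_on (\<lambda>f. synth f +o N) (pts (as_space L))"
    proof (rule inj_onI)
      fix f g assume fg: "f \<in> pts (as_space L)" "g \<in> pts (as_space L)" "synth f +o N = synth g +o N"
      then have L: "f \<in> L" "g \<in> L" by (simp_all add: as_space_def)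
      have "ev (synth f - synth g) = 0"
        using fg(3) by (intro ev_N) (simp add: coset_eq_iff)
      then show "f = g"
        using L by (simp add: lin_ext_diff[OF synth_Free synth_Free] ev_synth_L)
    qed
  qed (simp add: pts_tensor as_space_def)
qed (simp_all add: as_space_def tensor_simps synth_add synth_scale coset_add coset_scale)

text \<open>Every coset is that of some \<open>synth f\<close>, a combination of the finitely many
  tuples \<open>diff_basis \<alpha>\<close>, whose cosets serve as generators.\<close>

lemma finite_dimensional_tensor: "finite_dimensional (tensor_product I W)"
  unfolding finite_dimensional_def
proof (intro exI[of _ "(\<lambda>\<alpha>. basis_vec (diff_basis \<alpha>) +o N) ` slots"] conjI allI impI)
  show "finite ((\<lambda>\<alpha>. basis_vec (diff_basis \<alpha>) +o N) ` slots)"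
    using finite_slots by simp
  show "(\<lambda>\<alpha>. basis_vec (diff_basis \<alpha>) +o N) ` slots \<subseteq> pts (tensor_product I W)"
    unfolding tensor_simps by (intro image_subsetI imageI basis_vec_free_space diff_basis_PiE)
next
  fix S
  assume S: "S \<noteq> {} \<and> (\<lambda>\<alpha>. basis_vec (diff_basis \<alpha>) +o N) ` slots \<subseteq> S
    \<and> S \<subseteq> pts (tensor_product I W)
    \<and> (\<forall>x\<in>S. \<forall>y\<in>S. vadd (tensor_product I W) x y \<in> S)
    \<and> (\<forall>c. \<forall>x\<in>S. vscale (tensor_product I W) c x \<in> S)"
  then have gens: "\<And>\<alpha>. \<alpha> \<in> slots \<Longrightarrow> basis_vec (diff_basis \<alpha>) +o N \<in> S"
    by (simp only: image_subset_iff)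
  have add: "(f + g) +o N \<in> S" if "f +o N \<in> S" "g +o N \<in> S" for f g
  proof -
    have "vadd (tensor_product I W) (f +o N) (g +o N) \<in> S" using S that by blast
    then show ?thesis by (simp only: tensor_simps coset_add)
  qed
  have scale: "cscale c f +o N \<in> S" if "f +o N \<in> S" for c f
  proof -
    have "vscale (tensor_product I W) c (f +o N) \<in> S" using S that by blast
    then show ?thesis by (simp only: tensor_simps coset_scale)
  qed
  \<comment> \<open>Scaling any coset in \<open>S\<close> by 0 gives the zero coset, the value of
    the empty combination.\<close>
  obtain g where "g +o N \<in> S" using S unfolding tensor_simps by blast
  from scale[OF this, of 0] have zero: "0 +o N \<in> S" by simp
  have comb: "(\<Sum>\<alpha>\<in>B. cscale (f \<alpha>) (basis_vec (diff_basis \<alpha>))) +o N \<in> S" if "finite B" "B \<subseteq> slots" for f B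
    using that
  proof (induction B)
    case empty
    then show ?case using zero by (simp only: sum.empty)
  next
    case (insert \<alpha> B)
    then have "basis_vec (diff_basis \<alpha>) +o N \<in> S" by (intro gens) simp
    moreover have "B \<subseteq> slots" using insert.prems by simp
    ultimately show ?case
      unfolding sum.insert[OF insert.hyps] by (intro add scale insert.IH)
  qed
  have "synth f +o N \<in> S" for f
    unfolding synth_def by (rule comb[OF finite_slots subset_refl])
  then have "pts (tensor_product I W) \<subseteq> S"
    unfolding pts_tensor by (intro image_subsetI)
  then show "S = pts (tensor_product I W)"
    using S by (intro equalityI) simp_all
qed

text \<open>The arrays \<open>pure_tensor I A u (diff_basis \<alpha>)\<close> form a basis:
  \<open>ev_synth\<close> shows that they span, and evaluation at the slots is dual to them.\<close>

lemma dim_L: "cfun.dim L = card slots"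
proof (rule cfun.dim_unique)
  let ?p = "\<lambda>\<alpha>. pure_tensor I A u (diff_basis \<alpha>)"
  have inj: "inj_on ?p slots"
  proof (rule inj_onI)
    fix \<alpha> \<beta> assume "\<alpha> \<in> slots" "\<beta> \<in> slots" "?p \<alpha> = ?p \<beta>"
    then show "\<alpha> = \<beta>"
      using pure_tensor_diff_basis[of \<alpha> \<beta>] pure_tensor_diff_basis[of \<beta> \<beta>] by (auto split: if_splits)
  qed
  then show "card (?p ` slots) = card slots" by (rule card_image)
  show "?p ` slots \<subseteq> L"
    using finite_I diff_basis_PiE by (auto intro!: pure_tensor_zero_line_sums simp: W_def)
  show "L \<subseteq> cfun.span (?p ` slots)"
  proof
    fix f assume "f \<in> L"
    then have "f = (\<Sum>\<alpha>\<in>slots. cscale (f \<alpha>) (?p \<alpha>))"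
      using ev_synth_L ev_synth by simp
    also have "\<dots> \<in> cfun.span (?p ` slots)"
      by (intro cfun.span_sum cfun.span_scale cfun.span_base) auto
    finally show "f \<in> cfun.span (?p ` slots)" .
  qed
  show "cfun.independent (?p ` slots)"
  proof (rule cfun.independent_if_scalars_zero)
    fix c y assume eq: "(\<Sum>x\<in>?p ` slots. cscale (c x) x) = 0" and "y \<in> ?p ` slots"
    then obtain \<beta> where \<beta>: "\<beta> \<in> slots" "y = ?p \<beta>" by blast
    \<comment> \<open>Evaluation at \<beta> singles out the coefficient of
      \<open>?p \<beta>\<close>.\<close>
    have "(\<Sum>\<alpha>\<in>slots. cscale (c (?p \<alpha>)) (?p \<alpha>)) \<beta> = 0"
      using eq by (simp add: sum.reindex[OF inj])
    then show "c y = 0"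
      using \<beta> finite_slots
      by (simp add: sum_fun_apply pure_tensor_diff_basis if_distrib cong: if_cong)
  qed (use finite_slots in simp)
qed

end

section \<open>The spaces of the multishift\<close>

text \<open>Vertices are \<open>undefined\<close> off \<open>{1..d}\<close>, so those in
  \<open>sib_set\<close> agree with \<open>u\<close> everywhere off \<open>F\<close>.\<close>

lemma sib_set_eq_pbox:
  assumes F: "F \<subseteq> {1..d}" and u: "u \<in> prod_nodes d T"
    and sib: "\<And>j. j \<in> F \<Longrightarrow> sib (T j) (u j) \<subseteq> nodes (T j)"
  shows "sib_set d T F u = pbox F (\<lambda>j. sib (T j) (u j)) u"
proof -
  have mem: "w \<in> prod_nodes d T \<longleftrightarrow>
      (\<forall>j\<in>{1..d}. w j \<in> nodes (T j)) \<and> (\<forall>j. j \<notin> {1..d} \<longrightarrow> w j = undefined)" for w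
    by (auto simp: tree_prod_def PiE_iff extensional_def)
  show ?thesis
  proof (intro set_eqI iffI)
    fix w assume w: "w \<in> sib_set d T F u"
    have "w j = u j" if "j \<notin> F" for j
      using w u that unfolding sib_set_def mem by (cases "j \<in> {1..d}") auto
    then show "w \<in> pbox F (\<lambda>j. sib (T j) (u j)) u"
      using w F by (auto simp: sib_set_def pbox_def)
  next
    fix w assume w: "w \<in> pbox F (\<lambda>j. sib (T j) (u j)) u"
    have "w j \<in> nodes (T j)" if "j \<in> {1..d}" for j
      using w u sib that unfolding pbox_def mem by (cases "j \<in> F") auto
    moreover have "w j = undefined" if "j \<notin> {1..d}" for j
      using w u F that unfolding pbox_def mem by (cases "j \<in> F") auto
    ultimately show "w \<in> sib_set d T F u"
      using w unfolding sib_set_def mem by (auto simp: pbox_def)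
  qed
qed

text \<open>Off \<open>F\<close> the coordinates of \<open>w\<close> in \<open>{1..d}\<close> are
  already roots, so the restriction alters only coordinate \<open>j\<close>, which is then
  overwritten.\<close>

lemma restr_Phi:
  assumes "F \<subseteq> {1..d}" "u \<in> Phi d T F" "w \<in> pbox F A u" "j \<in> F"
  shows "(restr d T (F - {j}) w)(j := a) = w(j := a)"
proof
  fix i
  show "((restr d T (F - {j}) w)(j := a)) i = (w(j := a)) i"
    using assms by (cases "i \<in> {1..d}"; cases "i \<in> F")
      (auto simp: restr_def pbox_def Phi_def tree_prod_def PiE_iff extensional_def)
qed

text \<open>Finiteness matters because an infinite set has \<open>card\<close> 0, which would make
  the weight 0; \<open>1 \<le> d\<close> keeps the denominator positive at total depth 0.\<close>

lemma weight_pos: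
  assumes "1 \<le> d" "\<And>n. 0 < c n" "finite (Chi_at d T j (w(j := par (T j) (w j))))"
    and "w \<in> Chi_at d T j (w(j := par (T j) (w j)))"
  shows "0 < weight d T c j w"
proof -
  have "0 < card (Chi_at d T j (w(j := par (T j) (w j))))"
    using assms(3,4) by (auto simp: card_gt_0_iff)
  then show ?thesis
    using assms(1,2) unfolding weight_def Let_def
    by (intro mult_pos_pos) (auto intro!: divide_pos_pos add_nonneg_pos)
qed

text \<open>The weight depends on a vertex only through its parent in direction \<open>j\<close>,
  which siblings share, so a common positive factor cancels from each line equation.\<close>

lemma L_space_eq_zero_line_sums:
  assumes tree: "\<And>j. j \<in> {1..d} \<Longrightarrow> rooted_directed_tree (T j)"
    and lf: "\<And>j. j \<in> {1..d} \<Longrightarrow> locally_finite_tree (T j)"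
    and c: "\<And>n. 0 < c n" and F: "F \<subseteq> {1..d}" and u: "u \<in> Phi d T F"
    and fin: "\<And>j. j \<in> F \<Longrightarrow> finite (sib (T j) (u j))"
    and base: "\<And>j. j \<in> F \<Longrightarrow> u j \<in> sib (T j) (u j)"
    and sib: "\<And>j. j \<in> F \<Longrightarrow> sib (T j) (u j) \<subseteq> nodes (T j)"
  shows "L_space d T (weight d T c) F u = zero_line_sums F (\<lambda>j. sib (T j) (u j)) u"
proof -
  let ?A = "\<lambda>j. sib (T j) (u j)"
  let ?lam = "weight d T c"
  have uV: "u \<in> prod_nodes d T" using u by (simp add: Phi_def)
  have box: "sib_set d T F u = pbox F ?A u"
    using F uV sib by (rule sib_set_eq_pbox)
  have finF: "finite F" using F finite_subset by blast
  have V: "w \<in> prod_nodes d T" if "w \<in> pbox F ?A u" for w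
    using that unfolding box[symmetric] by (simp add: sib_set_def)
  have line: "(\<Sum>y \<in> sib_at d T j ((restr d T (F - {j}) w)(j := u j)). f y * of_real (?lam j y)) = 0
      \<longleftrightarrow> (\<Sum>a\<in>?A j. f (w(j := a))) = 0"
    if j: "j \<in> F" and w: "w \<in> pbox F ?A u" for j w and f :: "(nat \<Rightarrow> 'a) \<Rightarrow> complex"
  proof -
    have jd: "j \<in> {1..d}" using F j by blast
    \<comment> \<open>Turns the sum over siblings into a sum along the line through
      \<open>w\<close>.\<close>
    have img: "sib_at d T j (w(j := u j)) = (\<lambda>a. w(j := a)) ` ?A j"
    proof (intro set_eqI iffI)
      fix y assume y: "y \<in> sib_at d T j (w(j := u j))"
      have "y i = w i" if "i \<noteq> j" for i
        using y V[OF w] that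
        by (cases "i \<in> {1..d}") (auto simp: sib_at_def tree_prod_def PiE_iff extensional_def)
      then have "y = w(j := y j)" by auto
      then show "y \<in> (\<lambda>a. w(j := a)) ` ?A j" using y by (auto simp: sib_at_def)
    next
      fix y assume "y \<in> (\<lambda>a. w(j := a)) ` ?A j"
      then show "y \<in> sib_at d T j (w(j := u j))"
        using V[OF pbox_upd[OF w j]] by (auto simp: sib_at_def split: if_splits)
    qed
    have inj: "inj_on (\<lambda>a. w(j := a)) (?A j)"
      by (rule inj_onI) (metis fun_upd_same)
    have edge: "(par (T j) (u j), a) \<in> edges (T j)" if "a \<in> ?A j" for a
      using that by (simp add: sib_def Chi_def)
    then have par: "par (T j) a = par (T j) (u j)" if "a \<in> ?A j" for a
      using par_eq[OF tree[OF jd]] that by blast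
    have const: "?lam j (w(j := a)) = ?lam j (w(j := u j))" if "a \<in> ?A j" for a
      using par[OF that] by (simp add: weight_def)
    have "0 < ?lam j (w(j := u j))"
    proof (rule weight_pos[OF _ c])
      show "1 \<le> d" using jd by simp
      let ?v = "(w(j := u j))(j := par (T j) ((w(j := u j)) j))"
      have "par (T j) (u j) \<in> nodes (T j)"
        using edge[OF base[OF j]] tree[OF jd] by (auto simp: rooted_directed_tree_def)
      then have "?v \<in> prod_nodes d T"
        using V[OF w] jd by (auto simp: tree_prod_def PiE_iff extensional_def)
      then show "finite (Chi_at d T j ?v)"
        by (rule finite_Chi_at[where T = T, OF jd lf[OF jd]])
      show "w(j := u j) \<in> Chi_at d T j ?v"
        using V[OF pbox_upd[OF w j base[OF j]]] base[OF j] edge[OF base[OF j]]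
        by (auto simp: Chi_at_def Chi_def)
    qed
    then show ?thesis
      unfolding restr_Phi[OF F u w j] img
      by (simp add: sum.reindex[OF inj] const flip: sum_distrib_right)
  qed
  \<comment> \<open>On a finite box, membership in \<open>l2\<close> reduces to vanishing outside
    it.\<close>
  show ?thesis
    unfolding L_space_def zero_line_sums_def sib_restr_def box
    using finite_l2[OF finite_pbox[of F ?A u, OF finF fin]] line by auto
qed

theorem theorem2p3:
  fixes d :: nat and T :: "nat \<Rightarrow> 'a digraph" and \<cc> :: "nat \<Rightarrow> real"
    and F :: "nat set" and \<Omega> :: "(nat \<Rightarrow> 'a) set" and u :: "nat \<Rightarrow> 'a"
  assumes "\<And>j. j \<in> {1..d} \<Longrightarrow> rooted_directed_tree (T j)"
    and "\<And>j. j \<in> {1..d} \<Longrightarrow> countable (nodes (T j)) \<and> infinite (nodes (T j))"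
    and "\<And>j. j \<in> {1..d} \<Longrightarrow> leafless (T j)"
    and "\<And>j. j \<in> {1..d} \<Longrightarrow> locally_finite_tree (T j)"
    and "\<And>n. 0 < \<cc> n"
    and "multishift d T (weight d T \<cc>) \<in> shift_family d T"
    and "F \<subseteq> {1..d}" and "F \<noteq> {}"
    and "transversal d T F \<Omega>" and "u \<in> \<Omega>"
  shows "lin_isomorphic (as_space (L_space d T (weight d T \<cc>) F u))
           (tensor_product F (\<lambda>j. ker_X (T j) (u j))) \<and>
         finite_dimensional (tensor_product F (\<lambda>j. ker_X (T j) (u j))) \<and>
         int (cfun.dim (L_space d T (weight d T \<cc>) F u)) =
           (\<Prod>j\<in>F. (int (card (sib (T j) (u j))) - 1))"
proof -
  let ?A = "\<lambda>j. sib (T j) (u j)"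
  have u: "u \<in> Phi d T F"
    using assms(9,10) by (auto simp: transversal_def)
  \<comment> \<open>For \<open>j\<close> in \<open>F\<close> the vertex \<open>u j\<close> is not a
    root, so \<open>par\<close> is a genuine parent and local finiteness applies to its
    children.\<close>
  have A: "finite (?A j) \<and> u j \<in> ?A j \<and> ?A j \<subseteq> nodes (T j)" if "j \<in> F" for j
  proof -
    have jd: "j \<in> {1..d}" using assms(7) that by blast
    note tree = assms(1)[OF jd]
    have "u j \<in> nodes (T j)" "u j \<noteq> troot (T j)"
      using u jd that by (auto simp: Phi_def tree_prod_def PiE_iff)
    then obtain p where p: "(p, u j) \<in> edges (T j)"
      using not_root_iff[OF tree] by blast
    have "?A j = Chi (T j) p" by (simp add: sib_def par_eq[OF tree p])
    moreover have "edges (T j) \<subseteq> nodes (T j) \<times> nodes (T j)"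
      using tree by (simp add: rooted_directed_tree_def)
    ultimately show ?thesis
      using p assms(4)[OF jd] by (auto simp: Chi_def locally_finite_tree_def)
  qed
  interpret pointed_box F ?A u
    using A finite_subset[OF assms(7)] by unfold_locales auto
  have L: "L_space d T (weight d T \<cc>) F u = L"
    using A by (intro L_space_eq_zero_line_sums assms(1,4,5,7) u) auto
  \<comment> \<open>Off \<open>F\<close>, \<open>ker_X (T j) (u j)\<close> and \<open>W j\<close> may differ, as \<open>sib (T j) (u j)\<close> need not be finite.\<close>
  have ker: "ker_X (T j) (u j) = W j" if "j \<in> F" for j
    using A[OF that] by (auto simp: ker_X_def W_def zero_sum_def finite_l2 X_functional_def)
  have "(\<Pi>\<^sub>E j\<in>F. ker_X (T j) (u j)) = (\<Pi>\<^sub>E j\<in>F. W j)"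
    using ker by (rule PiE_cong)
  \<comment> \<open>The relations only update slots in \<open>F\<close>, where the two families
    agree.\<close>
  then have "multilinear_relations F (\<lambda>j. ker_X (T j) (u j)) = multilinear_relations F W"
    using ker unfolding multilinear_relations_def by (auto; metis)
  then have tensor: "tensor_product F (\<lambda>j. ker_X (T j) (u j)) = tensor_product F W"
    using \<open>(\<Pi>\<^sub>E j\<in>F. ker_X (T j) (u j)) = (\<Pi>\<^sub>E j\<in>F. W j)\<close> by (simp add: tensor_product_def)
  show ?thesis
    unfolding L tensor using lin_isomorphic_tensor finite_dimensional_tensor dim_L card_slots by simp
qed

end
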